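(* For $x,y\in{}^\bullet\mathbb{R}$ put $d_{\mathrm F}(x,y):=|{}^\circ x-{}^\circ y|$ and $d_\omega(x,y):=|{}^\circ x-{}^\circ y|+\omega(x-y)$. Then: (1) $d_{\mathrm F}:{}^\bullet\mathbb{R}\times{}^\bullet\mathbb{R}\to\mathbb{R}$ is a pseudometric. (2) $d_\omega:{}^\bullet\mathbb{R}\times{}^\bullet\mathbb{R}\to\mathbb{R}$ is a metric. (3) The topology generated by $d_\omega$ is finer than the topology generated by $d_{\mathrm F}$. (4) The topology generated by $d_{\mathrm F}$ is the Fermat topology on ${}^\bullet\mathbb{R}$. (5) $d_{\mathrm F}$ and $d_\omega$ are not topologically equivalent (they do not generate the same topology).
   Context: Fermat reals. A little-oh polynomial is a function $x:\mathbb{R}_{\ge0}\to\mathbb{R}$ such that $x(t)=r+\sum_{i=1}^N a_i t^{\alpha_i}+o(t)$ as $t\to0^+$, for some $N\in\mathbb{N}$, $r,a_i\in\mathbb{R}$, $\alpha_i\in\mathbb{R}_{\ge0}$. Put $x\sim y$ iff $x(t)=y(t)+o(t)$ as $t\to0^+$. The ring ${}^\bullet\mathbb{R}$ of Fermat reals is the quotient of the ring of little-oh polynomials (pointwise operations) by $\sim$; it contains $\mathbb{R}$ (classes of constants). For real $a>0$, $\mathrm{d}t_a$ denotes the class of $t\mapsto t^{1/a}$ (so $\mathrm{d}t_a=0$ iff $a<1$), and $\mathrm{d}t:=\mathrm{d}t_1$. Every $x\in{}^\bullet\mathbb{R}$ can be written uniquely as $x={}^\circ x+\sum_{i=1}^N\alpha_i\,\mathrm{d}t_{a_i}$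 with ${}^\circ x,\alpha_i\in\mathbb{R}$, $\alpha_i\ne0$, $a_1>\dots>a_N\ge1$, $N\ge0$ (the decomposition of $x$). ${}^\circ x$ is the standard part of $x$, and the order is $\omega(x):=a_1$ if $N\ge1$, $\omega(x):=0$ if $x\in\mathbb{R}$. Fermat topology: for $U\subseteq\mathbb{R}$ open put ${}^\bullet U:=\{x\in{}^\bullet\mathbb{R}\mid{}^\circ x\in U\}$. A set $A\subseteq{}^\bullet\mathbb{R}$ is open in the Fermat topology iff $A=\bigcup\{{}^\bullet U\mid U\text{ open in }\mathbb{R},\ {}^\bullet U\subseteq A\}$. *)

theory Defs
  imports "HOL-Analysis.Analysis" "HOL-Library.Landau_Symbols"
begin

section \<open>Little-oh polynomials\<close>

text \<open>
  Functions on the half-line of nonnegative reals are represented by total functions on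
  \<^typ>\<open>real\<close>. Only the germ at \<open>0\<^sup>+\<close> enters the definitions below, so the values at negative
  arguments are irrelevant and disappear in the quotient. For the same reason it does not matter
  that \<^term>\<open>(0::real) powr 0 = 0\<close>: every exponent is applied to \<open>t > 0\<close> only.
\<close>

definition little_oh_poly :: "(real \<Rightarrow> real) \<Rightarrow> bool" where
  "little_oh_poly x \<longleftrightarrow>
     (\<exists>(N::nat) (r::real) (a::nat \<Rightarrow> real) (\<alpha>::nat \<Rightarrow> real).
        (\<forall>i\<in>{1..N}. \<alpha> i \<ge> 0) \<and>
        (\<lambda>t. x t - (r + (\<Sum>i=1..N. a i * t powr \<alpha> i))) \<in> o[at_right 0](\<lambda>t. t))"

definition fermat_rel :: "(real \<Rightarrow> real) \<Rightarrow> (real \<Rightarrow> real) \<Rightarrow> bool" where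
  "fermat_rel x y \<longleftrightarrow>
     little_oh_poly x \<and> little_oh_poly y \<and> (\<lambda>t. x t - y t) \<in> o[at_right 0](\<lambda>t. t)"

lemma little_oh_polyI:
  fixes a \<alpha> :: "'i \<Rightarrow> real"
  assumes I: "finite I" and nn: "\<And>i. i \<in> I \<Longrightarrow> \<alpha> i \<ge> 0"
    and o: "(\<lambda>t. x t - (\<Sum>i\<in>I. a i * t powr \<alpha> i)) \<in> o[at_right 0](\<lambda>t. t)"
  shows "little_oh_poly x"
proof -
  obtain h where h: "bij_betw h {1..card I} I"
    using ex_bij_betw_nat_finite_1[OF I] by blast
  have "(\<Sum>i=1..card I. (a \<circ> h) i * t powr (\<alpha> \<circ> h) i) = (\<Sum>i\<in>I. a i * t powr \<alpha> i)" for t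
    using sum.reindex_bij_betw[OF h, of "\<lambda>i. a i * t powr \<alpha> i"] by simp
  moreover have "\<forall>i\<in>{1..card I}. (\<alpha> \<circ> h) i \<ge> 0"
    using h nn by (auto simp: bij_betw_def)
  ultimately show ?thesis
    unfolding little_oh_poly_def using o
    by (intro exI[of _ "card I"] exI[of _ 0] exI[of _ "a \<circ> h"] exI[of _ "\<alpha> \<circ> h"]) simp
qed

lemma little_oh_polyE:
  assumes "little_oh_poly x"
  obtains I :: "nat set" and a \<alpha> :: "nat \<Rightarrow> real"
  where "finite I" "\<And>i. i \<in> I \<Longrightarrow> \<alpha> i \<ge> 0"
    "(\<lambda>t. x t - (\<Sum>i\<in>I. a i * t powr \<alpha> i)) \<in> o[at_right 0](\<lambda>t. t)"
proof -
  from assms obtain N :: nat and r a \<alpha> where nn: "\<forall>i\<in>{1..N}. \<alpha> i \<ge> (0::real)"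
    and o: "(\<lambda>t. x t - (r + (\<Sum>i=1..N. a i * t powr \<alpha> i))) \<in> o[at_right 0](\<lambda>t. t)"
    unfolding little_oh_poly_def by blast
  define a' where "a' = a(0 := r)"
  define \<alpha>' where "\<alpha>' = \<alpha>(0 := 0)"
  have eq: "r + (\<Sum>i=1..N. a i * t powr \<alpha> i) = (\<Sum>i\<in>{0..N}. a' i * t powr \<alpha>' i)"
    if "t > 0" for t
  proof -
    have "(\<Sum>i\<in>{0..N}. a' i * t powr \<alpha>' i)
        = a' 0 * t powr \<alpha>' 0 + (\<Sum>i=1..N. a' i * t powr \<alpha>' i)"
      by (simp add: sum.atLeast_Suc_atMost)
    also have "(\<Sum>i=1..N. a' i * t powr \<alpha>' i) = (\<Sum>i=1..N. a i * t powr \<alpha> i)"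
      by (intro sum.cong) (auto simp: a'_def \<alpha>'_def)
    finally show ?thesis using that by (simp add: a'_def \<alpha>'_def)
  qed
  have "eventually (\<lambda>t::real. t > 0) (at_right 0)"
    by (simp add: eventually_at_right_less)
  then have "eventually (\<lambda>t. x t - (r + (\<Sum>i=1..N. a i * t powr \<alpha> i))
      = x t - (\<Sum>i\<in>{0..N}. a' i * t powr \<alpha>' i)) (at_right 0)"
    by eventually_elim (simp only: eq)
  from landau_o.small.in_cong[OF this] o
  have "(\<lambda>t. x t - (\<Sum>i\<in>{0..N}. a' i * t powr \<alpha>' i)) \<in> o[at_right 0](\<lambda>t. t)" by blast
  moreover have "\<alpha>' i \<ge> 0" if "i \<in> {0..N}" for i
    using nn that by (cases "i = 0") (auto simp: \<alpha>'_def)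
  ultimately show ?thesis using that[of "{0..N}" \<alpha>' a'] by blast
qed

lemma little_oh_poly_monom: "\<alpha> \<ge> 0 \<Longrightarrow> little_oh_poly (\<lambda>t. c * t powr \<alpha>)"
  by (rule little_oh_polyI[of "{()}" "\<lambda>_. \<alpha>" _ "\<lambda>_. c"]) auto

lemma little_oh_poly_const: "little_oh_poly (\<lambda>t. c)"
  unfolding little_oh_poly_def by (rule exI[of _ 0], rule exI[of _ c]) auto

lemma little_oh_poly_add:
  assumes "little_oh_poly x" "little_oh_poly y"
  shows "little_oh_poly (\<lambda>t. x t + y t)"
proof -
  obtain I :: "nat set" and a \<alpha> where 1: "finite I" "\<And>i. i \<in> I \<Longrightarrow> \<alpha> i \<ge> 0"
    "(\<lambda>t. x t - (\<Sum>i\<in>I. a i * t powr \<alpha> i)) \<in> o[at_right 0](\<lambda>t. t)"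
    by (rule little_oh_polyE[OF assms(1)]) blast
  obtain J :: "nat set" and b \<beta> where 2: "finite J" "\<And>i. i \<in> J \<Longrightarrow> \<beta> i \<ge> 0"
    "(\<lambda>t. y t - (\<Sum>i\<in>J. b i * t powr \<beta> i)) \<in> o[at_right 0](\<lambda>t. t)"
    by (rule little_oh_polyE[OF assms(2)]) blast
  have "(\<lambda>t. x t + y t - (\<Sum>i\<in>I <+> J. case_sum a b i * t powr case_sum \<alpha> \<beta> i))
     = (\<lambda>t. (x t - (\<Sum>i\<in>I. a i * t powr \<alpha> i)) + (y t - (\<Sum>i\<in>J. b i * t powr \<beta> i)))"
    using 1 2 by (simp add: sum.Plus fun_eq_iff)
  then show ?thesis
    using 1 2 sum_in_smallo(1)[OF 1(3) 2(3)]
    by (intro little_oh_polyI[of "I <+> J" "case_sum \<alpha> \<beta>" x' "case_sum a b" for x']) auto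
qed

lemma bigo_1_powr:
  fixes a \<alpha> :: "'i \<Rightarrow> real"
  assumes "finite I" "\<And>i. i \<in> I \<Longrightarrow> \<alpha> i \<ge> (0::real)"
  shows "(\<lambda>t. \<Sum>i\<in>I. a i * t powr \<alpha> i) \<in> O[at_right 0](\<lambda>t. 1::real)"
proof (rule big_sum_in_bigo)
  fix i assume i: "i \<in> I"
  have "eventually (\<lambda>t::real. t \<in> {0<..<1}) (at_right 0)"
    by (rule eventually_at_right_real) simp
  then have "eventually (\<lambda>t. norm (a i * t powr \<alpha> i) \<le> \<bar>a i\<bar> * norm (1::real)) (at_right 0)"
  proof eventually_elim
    case (elim t)
    then have "t powr \<alpha> i \<le> 1" using assms(2)[OF i] by (intro powr_le1) auto
    then show ?case by (simp add: abs_mult mult_left_le)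
  qed
  then show "(\<lambda>t. a i * t powr \<alpha> i) \<in> O[at_right 0](\<lambda>t. 1)" by (rule bigoI)
qed

lemma ident_smallo_imp_bigo_1:
  assumes "f \<in> o[at_right 0](\<lambda>t::real. t)"
  shows "f \<in> O[at_right 0](\<lambda>t. 1::real)"
proof -
  have "((\<lambda>t::real. t) \<longlongrightarrow> 0) (at_right 0)" by (rule tendsto_ident_at)
  then have "(\<lambda>t::real. t) \<in> O[at_right 0](\<lambda>t. 1::real)"
    by (intro landau_o.small_imp_big smalloI_tendsto) auto
  then show ?thesis
    using assms landau_o.small_imp_big landau_o.big_trans by blast
qed

lemma little_oh_poly_bounded:
  assumes "little_oh_poly x"
  shows "x \<in> O[at_right 0](\<lambda>t. 1)"
proof -
  obtain I :: "nat set" and a \<alpha> where 1: "finite I" "\<And>i. i \<in> I \<Longrightarrow> \<alpha> i \<ge> 0"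
    "(\<lambda>t. x t - (\<Sum>i\<in>I. a i * t powr \<alpha> i)) \<in> o[at_right 0](\<lambda>t. t)"
    by (rule little_oh_polyE[OF assms(1)]) blast
  from 1 have "(\<lambda>t. \<Sum>i\<in>I. a i * t powr \<alpha> i) \<in> O[at_right 0](\<lambda>t. 1)"
    by (intro bigo_1_powr)
  from sum_in_bigo(1)[OF ident_smallo_imp_bigo_1[OF 1(3)] this]
  show ?thesis by simp
qed

lemma mult_diff_smallo:
  assumes "x \<in> O[at_right 0](\<lambda>t. 1::real)" "y' \<in> O[at_right 0](\<lambda>t. 1::real)"
    and "(\<lambda>t. x t - x' t) \<in> o[at_right 0](\<lambda>t::real. t)"
    and "(\<lambda>t. y t - y' t) \<in> o[at_right 0](\<lambda>t::real. t)"
  shows "(\<lambda>t. x t * y t - x' t * y' t) \<in> o[at_right 0](\<lambda>t::real. t)"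
proof -
  have "(\<lambda>t. x t * (y t - y' t)) \<in> o[at_right 0](\<lambda>t. 1 * t)"
    by (rule landau_o.big_small_mult) (use assms in auto)
  moreover have "(\<lambda>t. (x t - x' t) * y' t) \<in> o[at_right 0](\<lambda>t. t * 1)"
    by (rule landau_o.small_big_mult) (use assms in auto)
  ultimately have "(\<lambda>t. x t * (y t - y' t) + (x t - x' t) * y' t) \<in> o[at_right 0](\<lambda>t. t)"
    using sum_in_smallo(1) by auto
  then show ?thesis by (simp add: algebra_simps)
qed

lemma little_oh_poly_mult:
  assumes "little_oh_poly x" "little_oh_poly y"
  shows "little_oh_poly (\<lambda>t. x t * y t)"
proof -
  obtain I :: "nat set" and a \<alpha> where 1: "finite I" "\<And>i. i \<in> I \<Longrightarrow> \<alpha> i \<ge> 0"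
    "(\<lambda>t. x t - (\<Sum>i\<in>I. a i * t powr \<alpha> i)) \<in> o[at_right 0](\<lambda>t. t)"
    by (rule little_oh_polyE[OF assms(1)]) blast
  obtain J :: "nat set" and b \<beta> where 2: "finite J" "\<And>i. i \<in> J \<Longrightarrow> \<beta> i \<ge> 0"
    "(\<lambda>t. y t - (\<Sum>i\<in>J. b i * t powr \<beta> i)) \<in> o[at_right 0](\<lambda>t. t)"
    by (rule little_oh_polyE[OF assms(2)]) blast
  let ?c = "\<lambda>(i, j). a i * b j" and ?e = "\<lambda>(i, j). \<alpha> i + \<beta> j"
  have "(\<Sum>i\<in>I. a i * t powr \<alpha> i) * (\<Sum>j\<in>J. b j * t powr \<beta> j)
      = (\<Sum>k\<in>I \<times> J. ?c k * t powr ?e k)" for t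
    unfolding sum_product sum.cartesian_product
    by (rule sum.cong) (auto simp: powr_add)
  moreover from 2 have "(\<lambda>t. \<Sum>i\<in>J. b i * t powr \<beta> i) \<in> O[at_right 0](\<lambda>t. 1)"
    by (intro bigo_1_powr)
  note mult_diff_smallo[OF little_oh_poly_bounded[OF assms(1)] this 1(3) 2(3)]
  ultimately have "(\<lambda>t. x t * y t - (\<Sum>k\<in>I \<times> J. ?c k * t powr ?e k)) \<in> o[at_right 0](\<lambda>t. t)"
    by simp
  then show ?thesis
    using 1 2 by (intro little_oh_polyI[of "I \<times> J" ?e _ ?c]) auto
qed

lemma little_oh_poly_uminus: "little_oh_poly x \<Longrightarrow> little_oh_poly (\<lambda>t. - x t)"
  using little_oh_poly_mult[OF little_oh_poly_const[of "-1"]] by simp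

lemma little_oh_poly_diff:
  "little_oh_poly x \<Longrightarrow> little_oh_poly y \<Longrightarrow> little_oh_poly (\<lambda>t. x t - y t)"
  using little_oh_poly_add[OF _ little_oh_poly_uminus[of y], of x] by simp


section \<open>The ring of Fermat reals\<close>

lemma fermat_rel_refl: "little_oh_poly x \<Longrightarrow> fermat_rel x x"
  by (simp add: fermat_rel_def)

lemma part_equivp_fermat_rel: "part_equivp fermat_rel"
proof (rule part_equivpI)
  show "\<exists>x. fermat_rel x x" using fermat_rel_refl[OF little_oh_poly_const] by blast
  show "symp fermat_rel"
  proof (rule sympI)
    fix x y assume "fermat_rel x y"
    then show "fermat_rel y x"
      using landau_o.small.uminus_in_iff[of "\<lambda>t. x t - y t" "at_right 0" "\<lambda>t. t"]
      by (auto simp: fermat_rel_def)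
  qed
  show "transp fermat_rel"
  proof (rule transpI)
    fix x y z assume "fermat_rel x y" "fermat_rel y z"
    then show "fermat_rel x z"
      using sum_in_smallo(1)[of "\<lambda>t. x t - y t" "at_right 0" "\<lambda>t. t" "\<lambda>t. y t - z t"]
      by (auto simp: fermat_rel_def)
  qed
qed

quotient_type fermat = "real \<Rightarrow> real" / partial: fermat_rel
  by (rule part_equivp_fermat_rel)

instantiation fermat :: comm_ring_1
begin

lift_definition zero_fermat :: fermat is "\<lambda>t. 0"
  by (rule fermat_rel_refl[OF little_oh_poly_const])

lift_definition one_fermat :: fermat is "\<lambda>t. 1"
  by (rule fermat_rel_refl[OF little_oh_poly_const])

lift_definition plus_fermat :: "fermat \<Rightarrow> fermat \<Rightarrow> fermat" is "\<lambda>x y t. x t + y t"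
  subgoal for x x' y y'
    using sum_in_smallo(1)[of "\<lambda>t. x t - x' t" "at_right 0" "\<lambda>t. t" "\<lambda>t. y t - y' t"]
    by (auto simp: fermat_rel_def little_oh_poly_add algebra_simps)
  done

lift_definition uminus_fermat :: "fermat \<Rightarrow> fermat" is "\<lambda>x t. - x t"
  subgoal for x x'
    using landau_o.small.uminus_in_iff[of "\<lambda>t. x t - x' t" "at_right 0" "\<lambda>t. t"]
    by (auto simp: fermat_rel_def little_oh_poly_uminus)
  done

lift_definition minus_fermat :: "fermat \<Rightarrow> fermat \<Rightarrow> fermat" is "\<lambda>x y t. x t - y t"
  subgoal for x x' y y'
    using sum_in_smallo(2)[of "\<lambda>t. x t - x' t" "at_right 0" "\<lambda>t. t" "\<lambda>t. y t - y' t"]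
    by (auto simp: fermat_rel_def little_oh_poly_diff algebra_simps)
  done

lift_definition times_fermat :: "fermat \<Rightarrow> fermat \<Rightarrow> fermat" is "\<lambda>x y t. x t * y t"
  subgoal for x x' y y'
    using mult_diff_smallo[of x y' x' y]
    by (auto simp: fermat_rel_def little_oh_poly_mult little_oh_poly_bounded)
  done

instance
proof
  have "(\<lambda>t. 1::real) \<notin> o[at_right 0](\<lambda>t::real. t)"
  proof
    assume o: "(\<lambda>t. 1::real) \<in> o[at_right 0](\<lambda>t::real. t)"
    from landau_o.smallD[OF o, of 1] have "eventually (\<lambda>t::real. 1 \<le> \<bar>t\<bar>) (at_right 0)"
      by simp
    moreover have "eventually (\<lambda>t::real. t \<in> {0<..<1}) (at_right 0)"
      by (rule eventually_at_right_real) simp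
    ultimately have "eventually (\<lambda>t::real. False) (at_right 0)"
      by eventually_elim auto
    then show False by simp
  qed
  then show "(0::fermat) \<noteq> 1"
    by transfer (auto simp: fermat_rel_def)
qed (transfer;
     auto simp: fermat_rel_def algebra_simps little_oh_poly_const
          intro!: little_oh_poly_add little_oh_poly_mult little_oh_poly_uminus little_oh_poly_diff)+

end

lift_definition fermat_of_real :: "real \<Rightarrow> fermat" is "\<lambda>r t. r"
  by (rule fermat_rel_refl[OF little_oh_poly_const])

text \<open>Only \<open>a > 0\<close> is meaningful; the value for \<open>a \<le> 0\<close> is a dummy.\<close>

lift_definition dt :: "real \<Rightarrow> fermat" is "\<lambda>a t. if a > 0 then t powr (1 / a) else 0"
  subgoal for a
    using little_oh_poly_monom[of "1 / a" 1]
    by (cases "a > 0") (auto intro!: fermat_rel_refl little_oh_poly_const)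
  done


section \<open>Decomposition, standard part and order\<close>

definition fermat_decomposition ::
    "fermat \<Rightarrow> real \<Rightarrow> nat \<Rightarrow> (nat \<Rightarrow> real) \<Rightarrow> (nat \<Rightarrow> real) \<Rightarrow> bool" where
  "fermat_decomposition x r N \<alpha> a \<longleftrightarrow>
     x = fermat_of_real r + (\<Sum>i=1..N. fermat_of_real (\<alpha> i) * dt (a i)) \<and>
     (\<forall>i\<in>{1..N}. \<alpha> i \<noteq> 0) \<and>
     (\<forall>i\<in>{1..N}. \<forall>j\<in>{1..N}. i < j \<longrightarrow> a i > a j) \<and>
     (\<forall>i\<in>{1..N}. a i \<ge> 1)"

text \<open>
  The following two descriptions are proper because the decomposition of a Fermat real exists
  and \<open>r\<close>, \<open>N\<close> and the values of \<open>\<alpha>\<close> and \<open>a\<close> on \<open>{1..N}\<close> are unique.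
\<close>

definition std_part :: "fermat \<Rightarrow> real" where
  "std_part x = (THE r. \<exists>N \<alpha> a. fermat_decomposition x r N \<alpha> a)"

definition fermat_order :: "fermat \<Rightarrow> real" where
  "fermat_order x =
     (THE w. \<exists>r N \<alpha> a. fermat_decomposition x r N \<alpha> a \<and> w = (if N \<ge> 1 then a 1 else 0))"


section \<open>The Fermat topology\<close>

definition fermat_ext :: "real set \<Rightarrow> fermat set" where
  "fermat_ext U = {x. std_part x \<in> U}"

definition fermat_open :: "fermat set \<Rightarrow> bool" where
  "fermat_open A \<longleftrightarrow> A = \<Union>{fermat_ext U | U. open U \<and> fermat_ext U \<subseteq> A}"

definition fermat_topology :: "fermat topology" where
  "fermat_topology = topology fermat_open"

lemma fermat_open_iff:
  "fermat_open A \<longleftrightarrow> (\<forall>x\<in>A. \<exists>U. open U \<and> x \<in> fermat_ext U \<and> fermat_ext U \<subseteq> A)"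
  unfolding fermat_open_def by blast

lemma istopology_fermat_open: "istopology fermat_open"
  unfolding istopology_def
proof (intro conjI allI impI)
  fix A B assume AB: "fermat_open A" "fermat_open B"
  show "fermat_open (A \<inter> B)"
    unfolding fermat_open_iff
  proof
    fix x assume "x \<in> A \<inter> B"
    with AB obtain U V where "open U" "x \<in> fermat_ext U" "fermat_ext U \<subseteq> A"
      "open V" "x \<in> fermat_ext V" "fermat_ext V \<subseteq> B"
      unfolding fermat_open_iff by (meson IntD1 IntD2)
    then show "\<exists>W. open W \<and> x \<in> fermat_ext W \<and> fermat_ext W \<subseteq> A \<inter> B"
      by (intro exI[of _ "U \<inter> V"]) (auto simp: fermat_ext_def)
  qed
next
  fix K assume K: "\<forall>A\<in>K. fermat_open A"
  show "fermat_open (\<Union>K)"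
    unfolding fermat_open_iff
  proof
    fix x assume "x \<in> \<Union>K"
    then obtain A where "A \<in> K" "x \<in> A" by blast
    with K obtain U where "open U" "x \<in> fermat_ext U" "fermat_ext U \<subseteq> A"
      unfolding fermat_open_iff by meson
    with \<open>A \<in> K\<close> show "\<exists>U. open U \<and> x \<in> fermat_ext U \<and> fermat_ext U \<subseteq> \<Union>K" by blast
  qed
qed

lemma openin_fermat_topology: "openin fermat_topology = fermat_open"
  unfolding fermat_topology_def by (rule topology_inverse'[OF istopology_fermat_open])


section \<open>Pseudometrics and their topologies\<close>

definition pseudometric :: "('a \<Rightarrow> 'a \<Rightarrow> real) \<Rightarrow> bool" where
  "pseudometric d \<longleftrightarrow>
     (\<forall>x y. d x y \<ge> 0) \<and> (\<forall>x. d x x = 0) \<and> (\<forall>x y. d x y = d y x) \<and>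
     (\<forall>x y z. d x z \<le> d x y + d y z)"

text \<open>
  The topology whose open sets are the unions of open balls. For a metric this is the library's
  \<^const>\<open>Metric_space.mtopology\<close>, see below; that constant is not used directly because its
  theory is not available for a \<open>d\<close> that is only a pseudometric.
\<close>

definition dist_topology :: "('a \<Rightarrow> 'a \<Rightarrow> real) \<Rightarrow> 'a topology" where
  "dist_topology d = topology (\<lambda>U. \<forall>x\<in>U. \<exists>r>0. {y. d x y < r} \<subseteq> U)"

lemma openin_dist_topology:
  "openin (dist_topology d) U \<longleftrightarrow> (\<forall>x\<in>U. \<exists>r>0. {y. d x y < r} \<subseteq> U)"
proof -
  have "istopology (\<lambda>U. \<forall>x\<in>U. \<exists>r>0. {y. d x y < r} \<subseteq> U)"
    unfolding istopology_def
  proof (intro conjI allI impI ballI)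
    fix S T x
    assume S: "\<forall>x\<in>S. \<exists>r>0. {y. d x y < r} \<subseteq> S" and T: "\<forall>x\<in>T. \<exists>r>0. {y. d x y < r} \<subseteq> T"
      and x: "x \<in> S \<inter> T"
    from S T x obtain r s where "r > 0" "{y. d x y < r} \<subseteq> S" "s > 0" "{y. d x y < s} \<subseteq> T"
      by (meson IntD1 IntD2)
    then show "\<exists>r>0. {y. d x y < r} \<subseteq> S \<inter> T"
      by (intro exI[of _ "min r s"]) auto
  next
    fix K x
    assume K: "\<forall>U\<in>K. \<forall>x\<in>U. \<exists>r>0. {y. d x y < r} \<subseteq> U" and "x \<in> \<Union>K"
    then obtain U where "U \<in> K" "x \<in> U" by blast
    with K obtain r where "r > 0" "{y. d x y < r} \<subseteq> U" by meson
    with \<open>U \<in> K\<close> show "\<exists>r>0. {y. d x y < r} \<subseteq> \<Union>K" by blast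
  qed
  then show ?thesis
    unfolding dist_topology_def by (simp add: topology_inverse')
qed

lemma openin_dist_topology_balls:
  assumes "pseudometric d"
  shows "openin (dist_topology d) U \<longleftrightarrow> (\<exists>B. U = (\<Union>(x, r)\<in>B. {y. d x y < r}))"
proof
  assume "openin (dist_topology d) U"
  then have "\<forall>x\<in>U. \<exists>r>0. {y. d x y < r} \<subseteq> U" by (simp add: openin_dist_topology)
  then obtain r where r: "\<And>x. x \<in> U \<Longrightarrow> r x > 0 \<and> {y. d x y < r x} \<subseteq> U" by metis
  have "d x x = 0" for x using assms by (simp add: pseudometric_def)
  with r have "U = (\<Union>(x, r)\<in>(\<lambda>x. (x, r x)) ` U. {y. d x y < r})"
    by (intro equalityI subsetI) (auto intro!: bexI)
  then show "\<exists>B. U = (\<Union>(x, r)\<in>B. {y. d x y < r})" by (rule exI)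
next
  assume "\<exists>B. U = (\<Union>(x, r)\<in>B. {y. d x y < r})"
  then obtain B where U: "U = (\<Union>(x, r)\<in>B. {y. d x y < r})" ..
  show "openin (dist_topology d) U"
    unfolding openin_dist_topology
  proof
    fix y assume "y \<in> U"
    then obtain x r where xr: "(x, r) \<in> B" "d x y < r" by (auto simp: U)
    have "{z. d y z < r - d x y} \<subseteq> {z. d x z < r}"
    proof safe
      fix z assume "d y z < r - d x y"
      moreover have "d x z \<le> d x y + d y z" using assms by (simp add: pseudometric_def)
      ultimately show "d x z < r" by simp
    qed
    with xr show "\<exists>s>0. {z. d y z < s} \<subseteq> U"
      by (intro exI[of _ "r - d x y"]) (auto simp: U)
  qed
qed

lemma dist_topology_eq_mtopology:
  assumes "Metric_space UNIV d"
  shows "dist_topology d = Metric_space.mtopology UNIV d"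
proof -
  interpret Metric_space UNIV d by fact
  show ?thesis
    by (simp add: topology_eq openin_dist_topology openin_mtopology mball_def Ball_def)
qed


section \<open>The two distances\<close>

definition d_F :: "fermat \<Rightarrow> fermat \<Rightarrow> real" where
  "d_F x y = \<bar>std_part x - std_part y\<bar>"

definition d_omega :: "fermat \<Rightarrow> fermat \<Rightarrow> real" where
  "d_omega x y = \<bar>std_part x - std_part y\<bar> + fermat_order (x - y)"

end

theory Submission
  imports Defs
begin

text \<open>
  Comparing the lowest powers of \<open>t\<close> shows that a Fermat real determines its finitely supported
  coefficient function on the exponents in \<open>[0, 1]\<close>. This function is additive in the Fermat real,
  the standard part is its value at \<open>0\<close>, and the order is the largest reciprocal of a nonzero
  exponent in its support. Hence the standard part is additive and the order is ultrametric, and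
  \<open>d_omega\<close> is a metric because a Fermat real of standard part and order \<open>0\<close> vanishes. The two
  topologies differ because \<open>dt\<close> has \<open>d_F\<close>-distance \<open>0\<close> but \<open>d_omega\<close>-distance \<open>1\<close> from \<open>0\<close>.
\<close>

section \<open>Powers of t and their finite sums as Fermat reals\<close>

text \<open>The guard allows every real exponent, so that \<open>tpow\<close> and
  \<open>germ_sum\<close> can be lifted as total functions.\<close>

lemma little_oh_poly_monom_guarded:
  "little_oh_poly (\<lambda>t. c * (if p \<ge> 0 then t powr p else 0))"
  by (cases "p \<ge> 0") (auto intro: little_oh_poly_monom little_oh_poly_const)

lemma little_oh_poly_sum_guarded:
  "little_oh_poly (\<lambda>t. \<Sum>i\<in>I. a i * (if \<alpha> i \<ge> 0 then t powr \<alpha> i else 0))"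
  by (induction I rule: infinite_finite_induct)
    (auto intro: little_oh_poly_const little_oh_poly_add little_oh_poly_monom_guarded)

text \<open>Indexing by the exponent instead of its reciprocal, as \<open>dt\<close> does, admits
  \<open>p = 0\<close>: the constant term becomes one more power.\<close>

lift_definition tpow :: "real \<Rightarrow> fermat" is "\<lambda>p t. if p \<ge> 0 then t powr p else 0"
  using little_oh_poly_monom_guarded[of 1] by (simp add: fermat_rel_refl)

text \<open>The sum is formed on representatives, not in the ring; \<open>germ_sum_eq\<close>
  identifies the two and so links ring equations to asymptotics.\<close>

lift_definition germ_sum :: "'i set \<Rightarrow> ('i \<Rightarrow> real) \<Rightarrow> ('i \<Rightarrow> real) \<Rightarrow> fermat"
  is "\<lambda>I a \<alpha> t. \<Sum>i\<in>I. a i * (if \<alpha> i \<ge> 0 then t powr \<alpha> i else 0)"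
  by (rule fermat_rel_refl[OF little_oh_poly_sum_guarded])

lemma fermat_of_real_add: "fermat_of_real (a + b) = fermat_of_real a + fermat_of_real b"
  by transfer (rule fermat_rel_refl[OF little_oh_poly_const])

lemma fermat_of_real_uminus: "fermat_of_real (- a) = - fermat_of_real a"
  by transfer (rule fermat_rel_refl[OF little_oh_poly_const])

lemma fermat_of_real_0 [simp]: "fermat_of_real 0 = 0"
  by transfer (rule fermat_rel_refl[OF little_oh_poly_const])

lemma fermat_of_real_1 [simp]: "fermat_of_real 1 = 1"
  by transfer (rule fermat_rel_refl[OF little_oh_poly_const])

lemma germ_sum_insert:
  assumes "finite I" "i \<notin> I"
  shows "germ_sum (insert i I) a \<alpha> = fermat_of_real (a i) * tpow (\<alpha> i) + germ_sum I a \<alpha>"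
  using assms little_oh_poly_monom_guarded[of 1 "\<alpha> i"] little_oh_poly_monom_guarded[of "a i" "\<alpha> i"]
    little_oh_poly_sum_guarded[where I = I and a = a and \<alpha> = \<alpha>]
  by (simp add: germ_sum.abs_eq tpow.abs_eq fermat_of_real.abs_eq plus_fermat.abs_eq
      times_fermat.abs_eq fermat_rel_refl little_oh_poly_const)

lemma germ_sum_eq:
  "finite I \<Longrightarrow> germ_sum I a \<alpha> = (\<Sum>i\<in>I. fermat_of_real (a i) * tpow (\<alpha> i))"
  by (induction I rule: finite_induct)
    (simp add: germ_sum.abs_eq zero_fermat_def, simp add: germ_sum_insert)

lemma tpow_0 [simp]: "tpow 0 = 1"
proof transfer
  \<comment> \<open>As \<open>0 powr 0 = 0\<close>, the two representatives differ at
    \<open>t = 0\<close>; they agree for positive \<open>t\<close>, which is all that the germ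
    sees.\<close>
  have "eventually (\<lambda>t::real. t powr 0 - 1 = 0) (at_right 0)"
    using eventually_at_right_less[of "0::real"] by eventually_elim simp
  from landau_o.small.in_cong[OF this]
  have "(\<lambda>t::real. t powr 0 - 1) \<in> o[at_right 0](\<lambda>t. t)" by simp
  moreover have "little_oh_poly (\<lambda>t. t powr 0)"
    using little_oh_poly_monom[of 0 1] by (simp del: powr_zero_eq_one)
  ultimately show "fermat_rel (\<lambda>t. if 0 \<le> (0::real) then t powr 0 else 0) (\<lambda>t. 1)"
    by (simp add: fermat_rel_def little_oh_poly_const del: powr_zero_eq_one)
qed

section \<open>Asymptotic comparison of powers\<close>

lemma powr_smallo:
  assumes "p < q"
  shows "(\<lambda>t::real. t powr q) \<in> o[at_right 0](\<lambda>t. t powr p)"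
proof (rule smalloI_tendsto)
  have "((\<lambda>t::real. t powr (q - p)) \<longlongrightarrow> 0) (at_right 0)"
    using assms by (intro tendsto_zero_powrI[OF _ tendsto_const])
      (auto intro: eventually_mono[OF eventually_at_right_less])
  then show "((\<lambda>t::real. t powr q / t powr p) \<longlongrightarrow> 0) (at_right 0)"
    by (simp add: powr_diff)
  show "eventually (\<lambda>t::real. t powr p \<noteq> 0) (at_right 0)"
    using eventually_at_right_less[of "0::real"] by eventually_elim simp
qed

lemma powr_1_smallo_iff:
  "f \<in> o[at_right 0](\<lambda>t::real. t powr 1) \<longleftrightarrow> f \<in> o[at_right 0](\<lambda>t::real. t)"
proof -
  have "eventually (\<lambda>t::real. t powr 1 = t) (at_right 0)"
    using eventually_at_right_less[of "0::real"] by eventually_elim simp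
  from landau_o.small.cong[OF this] show ?thesis by simp
qed

text \<open>Such a power is o(t). Hence only exponents in \<open>{0..1}\<close> survive in the
  quotient.\<close>

lemma tpow_eq_0: "p > 1 \<Longrightarrow> tpow p = 0"
  using powr_smallo[of 1 p] little_oh_poly_monom[of p 1]
  by transfer (auto simp: fermat_rel_def little_oh_poly_const powr_1_smallo_iff)

lemma dt_eq_tpow: "a > 0 \<Longrightarrow> dt a = tpow (1 / a)"
  by transfer (use little_oh_poly_monom[of _ 1] in \<open>auto intro!: fermat_rel_refl\<close>)

text \<open>If some coefficient were nonzero, the lowest occurring power \<open>t\<^sup>m\<close> would be \<open>o(t\<^sup>m)\<close>.\<close>

lemma sum_powr_smallo_imp_0:
  fixes c :: "real \<Rightarrow> real"
  assumes "finite S" "S \<subseteq> {0..1}"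
    and o: "(\<lambda>t. \<Sum>p\<in>S. c p * t powr p) \<in> o[at_right 0](\<lambda>t::real. t)"
    and "p \<in> S"
  shows "c p = 0"
proof (rule ccontr)
  assume "c p \<noteq> 0"
  define T where "T = {p\<in>S. c p \<noteq> 0}"
  define m where "m = Min T"
  have T: "finite T" "T \<noteq> {}" using assms \<open>c p \<noteq> 0\<close> by (auto simp: T_def)
  then have m: "m \<in> T" "\<And>q. q \<in> T \<Longrightarrow> m \<le> q" by (auto simp: m_def)
  then have "m \<le> 1" using assms by (auto simp: T_def)
  have t1: "eventually (\<lambda>t::real. t powr 1 = t) (at_right 0)"
    using eventually_at_right_less[of "0::real"] by eventually_elim simp
  \<comment> \<open>As \<open>m \<le> 1\<close>, the gauge t may be weakened to the lowest power;
    this is where \<open>S \<subseteq> {0..1}\<close> is needed.\<close>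
  have "(\<lambda>t::real. t powr 1) \<in> O[at_right 0](\<lambda>t. t powr m)"
  proof (cases "m = 1")
    case False
    with \<open>m \<le> 1\<close> show ?thesis by (intro landau_o.small_imp_big powr_smallo) simp
  qed (simp only: landau_o.big_refl)
  then have "(\<lambda>t::real. t) \<in> O[at_right 0](\<lambda>t. t powr m)"
    by (rule iffD1[OF landau_o.big.in_cong[OF t1]])
  with o have lhs: "(\<lambda>t. \<Sum>p\<in>S. c p * t powr p) \<in> o[at_right 0](\<lambda>t. t powr m)"
    by (rule landau_o.small_big_trans)
  have rest: "(\<lambda>t. \<Sum>p\<in>T - {m}. c p * t powr p) \<in> o[at_right 0](\<lambda>t. t powr m)"
  proof (intro big_sum_in_smallo)
    fix q assume "q \<in> T - {m}"
    then have "m < q" using m(2)[of q] by auto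
    from powr_smallo[OF this] show "(\<lambda>t. c q * t powr q) \<in> o[at_right 0](\<lambda>t. t powr m)"
      by simp
  qed
  have "(\<Sum>p\<in>S. c p * t powr p) - (\<Sum>p\<in>T - {m}. c p * t powr p) = c m * t powr m" for t
  proof -
    have "(\<Sum>p\<in>S. c p * t powr p) = (\<Sum>p\<in>T. c p * t powr p)"
      using assms(1) by (intro sum.mono_neutral_right) (auto simp: T_def)
    then show ?thesis by (simp add: sum.remove[OF T(1) m(1)])
  qed
  with sum_in_smallo(2)[OF lhs rest] have "(\<lambda>t. c m * t powr m) \<in> o[at_right 0](\<lambda>t. t powr m)"
    by (simp only:)
  then have "(\<lambda>t::real. t powr m) \<in> o[at_right 0](\<lambda>t. t powr m)"
    using m(1) by (simp add: T_def)
  then have "eventually (\<lambda>t::real. t powr m = 0) (at_right 0)"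
    by (simp add: landau_o.small_refl_iff)
  with eventually_at_right_less[of "0::real"]
  have "eventually (\<lambda>t::real. False) (at_right 0)"
    by eventually_elim simp
  then show False by simp
qed

section \<open>Expansions: existence, uniqueness and additivity\<close>

text \<open>A Fermat real is encoded by its coefficient function, indexed by the exponents \<open>1 / a\<^sub>i\<close>;
  the standard part is the coefficient of \<open>t\<^sup>0\<close>.\<close>

definition expansion :: "fermat \<Rightarrow> (real \<Rightarrow> real) \<Rightarrow> bool" where
  "expansion x c \<longleftrightarrow> finite {p. c p \<noteq> 0} \<and> {p. c p \<noteq> 0} \<subseteq> {0..1} \<and>
     x = (\<Sum>p | c p \<noteq> 0. fermat_of_real (c p) * tpow p)"

text \<open>The junk value \<open>inverse 0 = 0\<close> makes the standard part not contribute.\<close>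

definition coeff_order :: "(real \<Rightarrow> real) \<Rightarrow> real" where
  "coeff_order c = Max (insert 0 (inverse ` {p. c p \<noteq> 0}))"

text \<open>Zero coefficients contribute nothing, so any finite superset of the support within
  \<open>{0..1}\<close> will do and the exact support need not be computed.\<close>

lemma expansionI:
  assumes "finite S" "S \<subseteq> {0..1}" "\<And>p. p \<notin> S \<Longrightarrow> c p = 0"
    "x = (\<Sum>p\<in>S. fermat_of_real (c p) * tpow p)"
  shows "expansion x c"
proof -
  have sub: "{p. c p \<noteq> 0} \<subseteq> S" using assms(3) by blast
  then have "(\<Sum>p | c p \<noteq> 0. fermat_of_real (c p) * tpow p) = x"
    unfolding assms(4) using assms(1) by (intro sum.mono_neutral_left) auto
  then show ?thesis
    using sub assms finite_subset unfolding expansion_def by blast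
qed

lemma expansion_sum:
  assumes "expansion x c" "finite S" "{p. c p \<noteq> 0} \<subseteq> S"
  shows "x = (\<Sum>p\<in>S. fermat_of_real (c p) * tpow p)"
proof -
  have "(\<Sum>p | c p \<noteq> 0. fermat_of_real (c p) * tpow p) = (\<Sum>p\<in>S. fermat_of_real (c p) * tpow p)"
    using assms by (intro sum.mono_neutral_left) auto
  with assms(1) show ?thesis by (simp add: expansion_def)
qed

lemma expansion_0: "expansion 0 (\<lambda>p. 0)"
  by (simp add: expansion_def)

lemma expansion_add:
  assumes "expansion x c" "expansion y d"
  shows "expansion (x + y) (\<lambda>p. c p + d p)"
proof (rule expansionI)
  \<comment> \<open>Coefficients may cancel, so both summands are expanded over the union of the
    supports.\<close>
  let ?S = "{p. c p \<noteq> 0} \<union> {p. d p \<noteq> 0}"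
  show S: "finite ?S" "?S \<subseteq> {0..1}" using assms by (auto simp: expansion_def)
  show "x + y = (\<Sum>p\<in>?S. fermat_of_real (c p + d p) * tpow p)"
    using expansion_sum[OF assms(1) S(1)] expansion_sum[OF assms(2) S(1)]
    by (simp add: fermat_of_real_add distrib_right sum.distrib)
qed auto

lemma expansion_uminus: "expansion x c \<Longrightarrow> expansion (- x) (\<lambda>p. - c p)"
  by (simp add: expansion_def fermat_of_real_uminus sum_negf)

lemma expansion_diff:
  "expansion x c \<Longrightarrow> expansion y d \<Longrightarrow> expansion (x - y) (\<lambda>p. c p - d p)"
  using expansion_add[OF _ expansion_uminus[of y d], of x c] by simp

lemma expansion_tpow:
  assumes "p \<in> {0..1}"
  shows "expansion (fermat_of_real r * tpow p) (\<lambda>q. if q = p then r else 0)"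
  by (rule expansionI[of "{p}"]) (use assms in auto)

text \<open>On representatives, the equation with 0 says that a finite sum of powers is o(t), and
  \<open>sum_powr_smallo_imp_0\<close> applies.\<close>

lemma expansion_zero_unique:
  assumes "expansion 0 c"
  shows "c = (\<lambda>p. 0)"
proof -
  let ?S = "{p. c p \<noteq> 0}"
  have S: "finite ?S" "?S \<subseteq> {0..1}" using assms by (auto simp: expansion_def)
  have "germ_sum ?S c (\<lambda>p. p) = 0"
    using assms S by (simp add: germ_sum_eq expansion_def)
  then have "fermat_rel (\<lambda>t. \<Sum>p\<in>?S. c p * (if p \<ge> 0 then t powr p else 0)) (\<lambda>t. 0)"
    unfolding germ_sum.abs_eq zero_fermat_def
    by (intro iffD1[OF Quotient_rel[OF Quotient_fermat]])
      (simp add: fermat_rel_refl little_oh_poly_sum_guarded little_oh_poly_const)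
  then have "(\<lambda>t. \<Sum>p\<in>?S. c p * (if p \<ge> 0 then t powr p else 0)) \<in> o[at_right 0](\<lambda>t::real. t)"
    by (simp add: fermat_rel_def)
  moreover have "(\<Sum>p\<in>?S. c p * (if p \<ge> 0 then t powr p else 0)) = (\<Sum>p\<in>?S. c p * t powr p)" for t
    using S by (intro sum.cong) auto
  ultimately have "(\<lambda>t. \<Sum>p\<in>?S. c p * t powr p) \<in> o[at_right 0](\<lambda>t::real. t)"
    by simp
  from sum_powr_smallo_imp_0[OF S this] show ?thesis by blast
qed

text \<open>The difference of two expansions of \<open>x\<close> is an expansion of 0.\<close>

lemma expansion_unique:
  assumes "expansion x c" "expansion x d"
  shows "c = d"
  using expansion_zero_unique[of "\<lambda>p. c p - d p"] expansion_diff[OF assms]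
  by (simp add: fun_eq_iff)

text \<open>Dropping the o(t) remainder of a representative does not change its class.\<close>

lemma ex_germ_sum:
  fixes x :: fermat
  obtains I :: "nat set" and a \<alpha> where "finite I" "\<And>i. i \<in> I \<Longrightarrow> \<alpha> i \<ge> 0" "x = germ_sum I a \<alpha>"
proof -
  define f where "f = rep_fermat x"
  have "fermat_rel f f" and x: "x = abs_fermat f"
    using Quotient_rep_reflp[OF Quotient_fermat] Quotient_abs_rep[OF Quotient_fermat]
    by (simp_all add: f_def)
  then have f: "little_oh_poly f" by (simp add: fermat_rel_def)
  then obtain I :: "nat set" and a \<alpha> where I: "finite I" "\<And>i. i \<in> I \<Longrightarrow> \<alpha> i \<ge> 0"
    "(\<lambda>t. f t - (\<Sum>i\<in>I. a i * t powr \<alpha> i)) \<in> o[at_right 0](\<lambda>t. t)"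
    by (rule little_oh_polyE) blast
  have "(\<Sum>i\<in>I. a i * (if \<alpha> i \<ge> 0 then t powr \<alpha> i else 0)) = (\<Sum>i\<in>I. a i * t powr \<alpha> i)" for t
    using I(2) by (intro sum.cong) auto
  with f I(3) little_oh_poly_sum_guarded[where I = I and a = a and \<alpha> = \<alpha>]
  have "fermat_rel f (\<lambda>t. \<Sum>i\<in>I. a i * (if \<alpha> i \<ge> 0 then t powr \<alpha> i else 0))"
    by (simp add: fermat_rel_def)
  then have "x = germ_sum I a \<alpha>"
    unfolding x germ_sum.abs_eq by (rule Quotient_rel_abs[OF Quotient_fermat])
  with I(1,2) that show ?thesis by blast
qed

text \<open>Terms are added one at a time: an exponent up to 1 gives a one-point expansion, a larger
  one gives 0, and \<open>expansion_add\<close> merges repeated exponents.\<close>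

lemma expansion_exists: "\<exists>c. expansion x c"
proof -
  obtain I :: "nat set" and a \<alpha>
    where I: "finite I" "\<And>i. i \<in> I \<Longrightarrow> \<alpha> i \<ge> 0" "x = germ_sum I a \<alpha>"
    by (rule ex_germ_sum[of x]) blast
  from I(1,2) have "\<exists>c. expansion (\<Sum>i\<in>I. fermat_of_real (a i) * tpow (\<alpha> i)) c"
  proof (induction I rule: finite_induct)
    case empty
    then show ?case using expansion_0 by auto
  next
    case (insert i I)
    have "\<exists>d. expansion (fermat_of_real (a i) * tpow (\<alpha> i)) d"
    proof (cases "\<alpha> i \<le> 1")
      case True
      with insert.prems[of i] show ?thesis using expansion_tpow[of "\<alpha> i"] by auto
    next
      case False
      then show ?thesis using expansion_0 by (auto simp: tpow_eq_0)
    qed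
    with insert show ?case using expansion_add by fastforce
  qed
  with I show ?thesis by (simp add: germ_sum_eq)
qed

section \<open>From decompositions to standard part and order\<close>

text \<open>Reduces uniqueness of the standard part and of the order to uniqueness of the expansion:
  both are read off from \<open>c\<close>.\<close>

lemma decomposition_expansion:
  assumes "fermat_decomposition x r N \<alpha> a"
  obtains c where "expansion x c" "r = c 0" "(if N \<ge> 1 then a 1 else 0) = coeff_order c"
proof -
  let ?e = "\<lambda>i. 1 / a i"
  let ?E = "?e ` {1..N}"
  have x: "x = fermat_of_real r + (\<Sum>i=1..N. fermat_of_real (\<alpha> i) * dt (a i))"
    and nz: "\<And>i. i \<in> {1..N} \<Longrightarrow> \<alpha> i \<noteq> 0"
    and dec: "\<And>i j. i \<in> {1..N} \<Longrightarrow> j \<in> {1..N} \<Longrightarrow> i < j \<Longrightarrow> a i > a j"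
    and ge1: "\<And>i. i \<in> {1..N} \<Longrightarrow> a i \<ge> 1"
    using assms unfolding fermat_decomposition_def by blast+
  have inj: "inj_on ?e {1..N}"
  proof (rule inj_onI)
    fix i j assume ij: "i \<in> {1..N}" "j \<in> {1..N}" "1 / a i = 1 / a j"
    then have "a i = a j" by simp
    with dec[of i j] dec[of j i] ij show "i = j" by (cases i j rule: linorder_cases) auto
  qed
  \<comment> \<open>The inverse of \<open>?e\<close> recovers the index from the exponent. The value
    at 0 is free for \<open>r\<close> because all \<open>?e i\<close> are positive.\<close>
  define c where "c p = (if p = 0 then r else if p \<in> ?E then \<alpha> (the_inv_into {1..N} ?e p) else 0)" for p
  have pos: "?e i > 0" "?e i \<le> 1" if "i \<in> {1..N}" for i using ge1[OF that] by auto
  have c_e: "c (?e i) = \<alpha> i" if "i \<in> {1..N}" for i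
    using that pos[OF that] the_inv_into_f_f[OF inj that] by (auto simp: c_def)
  have c0: "c 0 = r" by (simp add: c_def)
  \<comment> \<open>The point 0 is removed because \<open>r\<close> may or may not vanish, whereas
    every \<open>\<alpha> i\<close> is nonzero.\<close>
  have supp: "{p. c p \<noteq> 0} - {0} = ?E"
    using c_e nz pos by (force simp: c_def split: if_splits)
  have notin: "0 \<notin> ?E" using pos by fastforce
  have "expansion x c"
  proof (rule expansionI[of "insert 0 ?E"])
    have "(\<Sum>p\<in>?E. fermat_of_real (c p) * tpow p) = (\<Sum>i=1..N. fermat_of_real (c (?e i)) * tpow (?e i))"
      by (subst sum.reindex[OF inj]) simp
    also have "\<dots> = (\<Sum>i=1..N. fermat_of_real (\<alpha> i) * dt (a i))"
    proof (rule sum.cong[OF refl])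
      fix i assume i: "i \<in> {1..N}"
      have "a i > 0" using ge1[OF i] by simp
      then show "fermat_of_real (c (?e i)) * tpow (?e i) = fermat_of_real (\<alpha> i) * dt (a i)"
        by (simp only: c_e[OF i] dt_eq_tpow)
    qed
    finally show "x = (\<Sum>p\<in>insert 0 ?E. fermat_of_real (c p) * tpow p)"
      using notin c0 x by simp
    show "insert 0 ?E \<subseteq> {0..1}" using pos by (force simp: less_imp_le)
  qed (use supp in auto)
  moreover have "(if N \<ge> 1 then a 1 else 0) = coeff_order c"
  proof -
    have "insert 0 (inverse ` {p. c p \<noteq> 0}) = insert 0 (inverse ` ({p. c p \<noteq> 0} - {0}))"
      by auto
    also have "\<dots> = insert 0 (a ` {1..N})"
      unfolding supp by (simp add: image_image)
    finally have "coeff_order c = Max (insert 0 (a ` {1..N}))" by (simp add: coeff_order_def)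
    \<comment> \<open>The \<open>a i\<close> decrease and are at least 1, so \<open>a 1\<close>
      dominates the inserted 0 too; for \<open>N = 0\<close> only that 0 is left.\<close>
    also have "\<dots> = (if N \<ge> 1 then a 1 else 0)"
    proof (cases "N \<ge> 1")
      case True
      then have "a i \<le> a 1" if "i \<in> {1..N}" for i
        using dec[of 1 i] that by (cases "i = 1") auto
      with True ge1[of 1] have "Max (insert 0 (a ` {1..N})) = a 1"
        by (intro Max_eqI) auto
      with True show ?thesis by simp
    qed simp
    finally show ?thesis by simp
  qed
  ultimately show ?thesis using that c0 by blast
qed

text \<open>Listing the nonzero exponents of an expansion in increasing order makes their
  reciprocals decrease, as a decomposition requires.\<close>

lemma decomposition_exists: "\<exists>r N \<alpha> a. fermat_decomposition x r N \<alpha> a"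
proof -
  obtain c where c: "expansion x c" using expansion_exists by blast
  let ?S = "{p. c p \<noteq> 0} - {0}"
  define l where "l = sorted_list_of_set ?S"
  define N where "N = length l"
  \<comment> \<open>Decompositions are indexed from 1, lists from 0.\<close>
  define e where "e i = l ! (i - 1)" for i
  have fin: "finite ?S" and sub: "?S \<subseteq> {0<..1}"
    using c by (auto simp: expansion_def subset_iff less_le)
  have l: "set l = ?S" "sorted_wrt (<) l"
    using fin by (simp_all add: l_def strict_sorted_list_of_set)
  have less: "e i < e j" if "i \<in> {1..N}" "j \<in> {1..N}" "i < j" for i j
    using sorted_wrt_nth_less[OF l(2), of "i - 1" "j - 1"] that by (auto simp: e_def N_def)
  have inj: "inj_on e {1..N}"
  proof (rule inj_onI)
    fix i j assume "i \<in> {1..N}" "j \<in> {1..N}" "e i = e j"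
    with less[of i j] less[of j i] show "i = j" by (cases i j rule: linorder_cases) auto
  qed
  have img: "e ` {1..N} = ?S"
  proof -
    have "e ` {1..N} = (\<lambda>i. l ! i) ` (\<lambda>i. i - 1) ` {1..N}" by (simp add: image_image e_def)
    also have "(\<lambda>i. i - 1) ` {1..N} = {..<N}"
      by (force simp: image_iff intro: bexI[of _ "Suc _"])
    finally show ?thesis using l(1) by (auto simp: set_conv_nth N_def)
  qed
  have e: "e i > 0" "e i \<le> 1" "c (e i) \<noteq> 0" if "i \<in> {1..N}" for i
  proof -
    have "e i \<in> ?S" using that img by blast
    with sub show "e i > 0" "e i \<le> 1" "c (e i) \<noteq> 0" by auto
  qed
  have "fermat_decomposition x (c 0) N (\<lambda>i. c (e i)) (\<lambda>i. 1 / e i)"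
    unfolding fermat_decomposition_def
  proof (intro conjI ballI impI)
    have "x = (\<Sum>p\<in>insert 0 ?S. fermat_of_real (c p) * tpow p)"
      by (rule expansion_sum[OF c]) (use fin in auto)
    also have "\<dots> = fermat_of_real (c 0) + (\<Sum>p\<in>?S. fermat_of_real (c p) * tpow p)"
      using fin by (subst sum.insert) auto
    also have "(\<Sum>p\<in>?S. fermat_of_real (c p) * tpow p)
        = (\<Sum>i=1..N. fermat_of_real (c (e i)) * tpow (e i))"
      unfolding img[symmetric] by (subst sum.reindex[OF inj]) simp
    also have "\<dots> = (\<Sum>i=1..N. fermat_of_real (c (e i)) * dt (1 / e i))"
      by (intro sum.cong refl) (use e in \<open>simp add: dt_eq_tpow\<close>)
    finally show "x = fermat_of_real (c 0) + \<dots>" .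
  next
    fix i j assume "i \<in> {1..N}" "j \<in> {1..N}" "i < j"
    with less e(1) show "1 / e j < 1 / e i" by (intro divide_strict_left_mono) auto
  qed (use e in auto)
  then show ?thesis by blast
qed

text \<open>Some decomposition exists, and each one induces the same expansion; so the definite
  description is proper.\<close>

lemma std_part_eq:
  assumes "expansion x c"
  shows "std_part x = c 0"
proof -
  have *: "r = c 0" if dec: "fermat_decomposition x r N \<alpha> a" for r N \<alpha> a
  proof -
    from dec obtain d where d: "expansion x d" "r = d 0" by (rule decomposition_expansion)
    with expansion_unique[OF assms d(1)] show ?thesis by simp
  qed
  obtain r N \<alpha> a where "fermat_decomposition x r N \<alpha> a"
    using decomposition_exists by blast
  with * have "\<exists>N \<alpha> a. fermat_decomposition x (c 0) N \<alpha> a" by blast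
  then show ?thesis
    unfolding std_part_def by (rule the_equality) (blast intro: *)
qed

lemma fermat_order_eq:
  assumes "expansion x c"
  shows "fermat_order x = coeff_order c"
proof -
  have *: "(if N \<ge> 1 then a 1 else 0) = coeff_order c"
    if dec: "fermat_decomposition x r N \<alpha> a" for r N \<alpha> a
  proof -
    from dec obtain d where d: "expansion x d" "(if N \<ge> 1 then a 1 else 0) = coeff_order d"
      by (rule decomposition_expansion)
    with expansion_unique[OF assms d(1)] show ?thesis by simp
  qed
  obtain r N \<alpha> a where "fermat_decomposition x r N \<alpha> a"
    using decomposition_exists by blast
  with *[OF this, symmetric]
  have "\<exists>r N \<alpha> a. fermat_decomposition x r N \<alpha> a \<and> coeff_order c = (if N \<ge> 1 then a 1 else 0)"
    by blast
  then show ?thesis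
    unfolding fermat_order_def
  proof (rule the_equality)
    fix w assume "\<exists>r N \<alpha> a. fermat_decomposition x r N \<alpha> a \<and> w = (if N \<ge> 1 then a 1 else 0)"
    then obtain r N \<alpha> a where "fermat_decomposition x r N \<alpha> a" "w = (if N \<ge> 1 then a 1 else 0)"
      by blast
    with * show "w = coeff_order c" by simp
  qed
qed

section \<open>Algebraic properties of standard part and order\<close>

lemma std_part_diff: "std_part (x - y) = std_part x - std_part y"
proof -
  obtain c where c: "expansion x c" using expansion_exists by blast
  obtain d where d: "expansion y d" using expansion_exists by blast
  show ?thesis
    using std_part_eq[OF c] std_part_eq[OF d] std_part_eq[OF expansion_diff[OF c d]] by simp
qed

lemma fermat_order_uminus: "fermat_order (- x) = fermat_order x"
proof -
  obtain c where "expansion x c" using expansion_exists by blast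
  from fermat_order_eq[OF this] fermat_order_eq[OF expansion_uminus[OF this]]
  show ?thesis by (simp add: coeff_order_def)
qed

lemma fermat_order_nonneg: "fermat_order x \<ge> 0"
proof -
  obtain c where c: "expansion x c" using expansion_exists by blast
  then have "finite {p. c p \<noteq> 0}" by (simp add: expansion_def)
  then show ?thesis by (simp add: fermat_order_eq[OF c] coeff_order_def)
qed

text \<open>The support of a sum lies in the union of the supports, and the maximum is
  monotone.\<close>

lemma fermat_order_add: "fermat_order (x + y) \<le> max (fermat_order x) (fermat_order y)"
proof -
  obtain c d where cd: "expansion x c" "expansion y d" using expansion_exists by blast
  let ?S = "\<lambda>c. insert 0 (inverse ` {p. c p \<noteq> (0::real)}) :: real set"
  have fin: "finite (?S c)" "finite (?S d)" using cd by (simp_all add: expansion_def)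
  have "Max (?S (\<lambda>p. c p + d p)) \<le> Max (?S c \<union> ?S d)"
    using fin by (intro Max_mono) auto
  also have "\<dots> = max (Max (?S c)) (Max (?S d))"
    using fin by (intro Max_Un) auto
  finally show ?thesis
    using cd expansion_add[OF cd] by (simp add: fermat_order_eq coeff_order_def)
qed

lemma fermat_order_0: "fermat_order 0 = 0"
  using fermat_order_eq[OF expansion_0] by (simp add: coeff_order_def)

text \<open>The coefficient at 0 is the standard part, and a nonzero coefficient at
  \<open>p > 0\<close> would force the order to be at least \<open>inverse p\<close>.\<close>

lemma eq_0_if_std_part_order_0:
  assumes "std_part x = 0" "fermat_order x = 0"
  shows "x = 0"
proof -
  obtain c where c: "expansion x c" using expansion_exists by blast
  have "c p = 0" for p
  proof (rule ccontr)
    assume "c p \<noteq> 0"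
    with c assms(1) have "p \<noteq> 0" by (auto simp: std_part_eq)
    with c \<open>c p \<noteq> 0\<close> have "p > 0" by (force simp: expansion_def)
    have "inverse p \<le> coeff_order c"
      unfolding coeff_order_def using c \<open>c p \<noteq> 0\<close> by (intro Max_ge) (auto simp: expansion_def)
    with \<open>p > 0\<close> show False using assms(2) fermat_order_eq[OF c] by simp
  qed
  with c show ?thesis by (simp add: expansion_def)
qed

section \<open>The two distances and their topologies\<close>

lemma pseudometric_d_F: "pseudometric d_F"
  by (auto simp: pseudometric_def d_F_def)

lemma Metric_space_d_omega: "Metric_space UNIV d_omega"
proof
  fix x y z
  show "0 \<le> d_omega x y" by (simp add: d_omega_def fermat_order_nonneg)
  show "d_omega x y = d_omega y x"
    using fermat_order_uminus[of "x - y"] by (simp add: d_omega_def abs_minus_commute)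
  show "d_omega x y = 0 \<longleftrightarrow> x = y"
  proof
    assume "d_omega x y = 0"
    then have "std_part (x - y) = 0" "fermat_order (x - y) = 0"
      \<comment> \<open>Both summands of \<open>d_omega\<close> are nonnegative, so each of them
        vanishes.\<close>
      using fermat_order_nonneg[of "x - y"] unfolding d_omega_def std_part_diff by linarith+
    from eq_0_if_std_part_order_0[OF this] show "x = y" by simp
  qed (simp add: d_omega_def fermat_order_0)
  show "d_omega x z \<le> d_omega x y + d_omega y z"
    \<comment> \<open>\<open>x - z\<close> is the sum of \<open>x - y\<close> and
      \<open>y - z\<close>, and a maximum of nonnegative numbers is at most their sum.\<close>
    using fermat_order_add[of "x - y" "y - z"] fermat_order_nonneg[of "x - y"]
      fermat_order_nonneg[of "y - z"]
    by (simp add: d_omega_def)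
qed

lemma d_F_le_d_omega: "d_F x y \<le> d_omega x y"
  by (simp add: d_F_def d_omega_def fermat_order_nonneg)

text \<open>A ball of the larger distance lies inside the ball of the smaller one with the same
  centre and radius.\<close>

lemma dist_topology_mono:
  assumes "\<And>x y. d x y \<le> d' x y" "openin (dist_topology d) U"
  shows "openin (dist_topology d') U"
  unfolding openin_dist_topology
proof
  fix x assume "x \<in> U"
  with assms(2) obtain r where "r > 0" "{y. d x y < r} \<subseteq> U"
    unfolding openin_dist_topology by meson
  with assms(1)[of x] show "\<exists>r>0. {y. d' x y < r} \<subseteq> U"
    using order.strict_trans1 by (intro exI[of _ r]) blast
qed

text \<open>The \<open>d_F\<close>-ball about \<open>x\<close> is \<open>fermat_ext\<close> of the
  real ball about \<open>std_part x\<close>, so both topologies reduce to open sets of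
  reals.\<close>

lemma dist_topology_d_F: "dist_topology d_F = fermat_topology"
  unfolding topology_eq
proof (intro allI iffI)
  fix A assume A: "openin (dist_topology d_F) A"
  show "openin fermat_topology A"
    unfolding openin_fermat_topology fermat_open_iff
  proof
    fix x assume "x \<in> A"
    with A obtain r where "r > 0" "{y. d_F x y < r} \<subseteq> A"
      unfolding openin_dist_topology by meson
    then show "\<exists>U. open U \<and> x \<in> fermat_ext U \<and> fermat_ext U \<subseteq> A"
      by (intro exI[of _ "ball (std_part x) r"]) (auto simp: fermat_ext_def d_F_def dist_real_def)
  qed
next
  fix A assume A: "openin fermat_topology A"
  show "openin (dist_topology d_F) A"
    unfolding openin_dist_topology
  proof
    fix x assume "x \<in> A"
    with A obtain U where U: "open U" "std_part x \<in> U" "fermat_ext U \<subseteq> A"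
      unfolding openin_fermat_topology fermat_open_iff fermat_ext_def by blast
    then obtain r where "r > 0" "ball (std_part x) r \<subseteq> U"
      using open_contains_ball by blast
    with U(3) show "\<exists>r>0. {y. d_F x y < r} \<subseteq> A"
      by (intro exI[of _ r]) (auto simp: fermat_ext_def d_F_def dist_real_def subset_iff)
  qed
qed

lemma std_part_dt_1: "std_part (dt 1) = 0" and fermat_order_dt_1: "fermat_order (dt 1) = 1"
proof -
  have "expansion (dt 1) (\<lambda>q. if q = 1 then 1 else 0)"
    using expansion_tpow[of 1 1] by (simp add: dt_eq_tpow)
  from std_part_eq[OF this] fermat_order_eq[OF this]
  show "std_part (dt 1) = 0" "fermat_order (dt 1) = 1" by (simp_all add: coeff_order_def)
qed

lemma dist_topology_d_F_neq_d_omega: "dist_topology d_F \<noteq> dist_topology d_omega"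
proof
  assume eq: "dist_topology d_F = dist_topology d_omega"
  interpret Metric_space UNIV d_omega by (rule Metric_space_d_omega)
  \<comment> \<open>Radius 1 is the order of \<open>dt 1\<close>: the strict inequality just
    excludes \<open>dt 1\<close>, which lies in every \<open>d_F\<close>-ball about 0.\<close>
  let ?B = "{y. d_omega 0 y < 1}"
  have "openin mtopology (mball 0 1)" by (rule openin_mball)
  then have "openin (dist_topology d_F) ?B"
    unfolding eq dist_topology_eq_mtopology[OF Metric_space_d_omega] by (simp add: mball_def)
  moreover have "0 \<in> ?B" by simp
  ultimately obtain r where r: "r > 0" "{y. d_F 0 y < r} \<subseteq> ?B"
    unfolding openin_dist_topology by blast
  have std0: "std_part 0 = 0" using std_part_diff[of 0 0] by simp
  have "dt 1 \<in> {y. d_F 0 y < r}" using r(1) by (simp add: d_F_def std0 std_part_dt_1)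
  with r(2) have "d_omega 0 (dt 1) < 1" by blast
  then show False
    by (simp add: d_omega_def std0 std_part_dt_1 fermat_order_uminus fermat_order_dt_1)
qed

theorem theorem2:
  shows "pseudometric d_F \<and>
    Metric_space UNIV d_omega \<and>
    (\<forall>U. openin (dist_topology d_F) U \<longrightarrow> openin (dist_topology d_omega) U) \<and>
    dist_topology d_F = fermat_topology \<and>
    dist_topology d_F \<noteq> dist_topology d_omega"
proof (intro conjI allI impI)
  show "openin (dist_topology d_omega) U" if "openin (dist_topology d_F) U" for U
    using d_F_le_d_omega that by (rule dist_topology_mono)
qed (fact pseudometric_d_F Metric_space_d_omega dist_topology_d_F dist_topology_d_F_neq_d_omega)+

end
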